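(* Let $G$ be a countable sofic group, $\Sigma$ a sofic approximation sequence for $G$, and $\pi:(X,G)\to(Y,G)$ a factor map between $G$-systems. Then $\mathrm{mdim}_\Sigma(Y|X)>0$ if and only if $\mathrm D_n^{\mathrm{md}}(Y|X,G,\Sigma)\neq\emptyset$ for some $n\ge2$.
   Context: For $d\in\mathbb N$ write $[d]=\{1,\dots,d\}$ and $\mathrm{Sym}(d)$ for the permutation group of $[d]$. A sofic approximation sequence for a countable group $G$ is a sequence of maps (not necessarily homomorphisms) $\Sigma=\{\sigma_i:G\to\mathrm{Sym}(d_i)\}_{i\ge1}$ such that $\frac1{d_i}|\{v\in[d_i]:\sigma_i(s)\sigma_i(t)(v)=\sigma_i(st)(v)\}|\to1$ for all $s,t\in G$, $\frac1{d_i}|\{v\in[d_i]:\sigma_i(s)(v)=\sigma_i(t)(v)\}|\to0$ for all distinct $s,t\in G$, and $d_i\to\infty$; $G$ is sofic if one exists. A $G$-system $(X,G)$ is a compact metric space $X$ with a continuous action of $G$ by homeomorphisms. A factor map $\pi:(X,G)\to(Y,G)$ is a continuous surjection with $\pi(gx)=g\pi(x)$. $\mathcal F(G)$ is the collection of nonempty finite subsets of $G$. For a compatible metric $\rho$ on $X$, $F\in\mathcal F(G)$, $\delta>0$ and a map $\sigma:G\to\mathrm{Sym}(d)$, $\mathrm{Map}(\rho,F,\delta,\sigma)\subset X^d$ is the set of maps $\xi:[d]\to X$ with $\big(\frac1d\sum_{a\in[d]}\rho(\xi(\sigma(s)(a)),s\,\xi(a))^2\big)^{1/2}\le\delta$ for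 all $s\in F$. Let $\pi^d:X^d\to Y^d$, $\xi\mapsto\pi\circ\xi$. For a finite open cover $\beta$ of a space $K$, $\mathrm{ord}(\beta)=\max_{x\in K}\sum_{U\in\beta}1_U(x)-1$, and $D(\beta)$ is the minimum of $\mathrm{ord}(\gamma)$ over finite open covers $\gamma$ of $K$ refining $\beta$ (every member of $\gamma$ is contained in a member of $\beta$); both are $-\infty$ if $K=\emptyset$. For a finite open cover $\alpha$ of $Y$, $\alpha^d$ is the cover of $Y^d$ by the sets $U_1\times\cdots\times U_d$, $U_j\in\alpha$, and $D(\pi,\alpha,\rho,F,\delta,\sigma)=D(\alpha^d|_{\pi^d(\mathrm{Map}(\rho,F,\delta,\sigma))})$. Let $$\mathrm{mdim}_\Sigma(\pi,\alpha)=\inf_{F\in\mathcal F(G)}\inf_{\delta>0}\limsup_{i\to\infty}\frac{D(\pi,\alpha,\rho,F,\delta,\sigma_i)}{d_i},\qquad\mathrm{mdim}_\Sigma(Y|X)=\sup_\alpha\mathrm{mdim}_\Sigma(\pi,\alpha),$$ the supremum over finite open covers $\alpha$ of $Y$; the limsup is $-\infty$ if $\mathrm{Map}(\rho,F,\delta,\sigma_i)=\emptyset$ for all large $i$. These values do not depend on the compatible metric $\rho$ on $X$. Let $\Delta_n(Y)=\{(y,\dots,y):y\in Y\}\subset Y^n$. For $(y_i)_{i=1}^n\in Y^n\setminus\Delta_n(Y)$, a finite open cover $\alpha$ of $Y$ is admissible with respect to $(y_i)_{i=1}^n$ if $\{y_1,\dots,y_n\}\not\subset\overline U$ for every $U\in\alpha$.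 For $n\ge2$, $\mathrm D_n^{\mathrm{md}}(Y|X,G,\Sigma)$ is the set of relative sofic mean dimension $n$-tuples, i.e. of $(y_i)_{i=1}^n\in Y^n\setminus\Delta_n(Y)$ such that $\mathrm{mdim}_\Sigma(\pi,\alpha)>0$ for every admissible open cover $\alpha$ with respect to $(y_i)_{i=1}^n$. *)

theory Defs
  imports "HOL-Analysis.Analysis" "HOL-Algebra.Group_Action" "HOL-Combinatorics.Permutations"
begin

text \<open>
  A sequence of maps from \<open>G\<close> to the permutations of \<open>{1..d i}\<close> is given by the sizes \<open>d\<close> together
  with \<open>\<sigma>\<close>. Sequences are indexed from \<open>0\<close>.
\<close>

definition sofic_approximation ::
    "('g, 'm) monoid_scheme \<Rightarrow> (nat \<Rightarrow> nat) \<Rightarrow> (nat \<Rightarrow> 'g \<Rightarrow> nat \<Rightarrow> nat) \<Rightarrow> bool" where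
  "sofic_approximation G d \<sigma> \<longleftrightarrow>
     (\<forall>i. \<forall>s\<in>carrier G. \<sigma> i s permutes {1..d i}) \<and>
     (\<forall>s\<in>carrier G. \<forall>t\<in>carrier G.
        (\<lambda>i. real (card {v \<in> {1..d i}. \<sigma> i s (\<sigma> i t v) = \<sigma> i (s \<otimes>\<^bsub>G\<^esub> t) v}) / real (d i))
          \<longlonglongrightarrow> 1) \<and>
     (\<forall>s\<in>carrier G. \<forall>t\<in>carrier G. s \<noteq> t \<longrightarrow>
        (\<lambda>i. real (card {v \<in> {1..d i}. \<sigma> i s v = \<sigma> i t v}) / real (d i)) \<longlonglongrightarrow> 0) \<and>
     filterlim d at_top sequentially"

definition sofic_group :: "('g, 'm) monoid_scheme \<Rightarrow> bool" where
  "sofic_group G \<longleftrightarrow>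
     group G \<and> countable (carrier G) \<and> (\<exists>d \<sigma>. sofic_approximation G d \<sigma>)"

definition G_system ::
    "('g, 'm) monoid_scheme \<Rightarrow> 'x topology \<Rightarrow> ('g \<Rightarrow> 'x \<Rightarrow> 'x) \<Rightarrow> bool" where
  "G_system G X \<phi> \<longleftrightarrow>
     compact_space X \<and> metrizable_space X \<and> group_action G (topspace X) \<phi> \<and>
     (\<forall>g\<in>carrier G. homeomorphic_map X X (\<phi> g))"

definition compatible_metric :: "'x topology \<Rightarrow> ('x \<Rightarrow> 'x \<Rightarrow> real) \<Rightarrow> bool" where
  "compatible_metric X \<rho> \<longleftrightarrow>
     Metric_space (topspace X) \<rho> \<and> Metric_space.mtopology (topspace X) \<rho> = X"

definition factor_map ::
    "('g, 'm) monoid_scheme \<Rightarrow> 'x topology \<Rightarrow> ('g \<Rightarrow> 'x \<Rightarrow> 'x) \<Rightarrow>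
     'y topology \<Rightarrow> ('g \<Rightarrow> 'y \<Rightarrow> 'y) \<Rightarrow> ('x \<Rightarrow> 'y) \<Rightarrow> bool" where
  "factor_map G X \<phi> Y \<psi> \<pi> \<longleftrightarrow>
     continuous_map X Y \<pi> \<and> \<pi> ` topspace X = topspace Y \<and>
     (\<forall>g\<in>carrier G. \<forall>x\<in>topspace X. \<pi> (\<phi> g x) = \<psi> g (\<pi> x))"

definition Map ::
    "'x topology \<Rightarrow> ('g \<Rightarrow> 'x \<Rightarrow> 'x) \<Rightarrow> ('x \<Rightarrow> 'x \<Rightarrow> real) \<Rightarrow> 'g set \<Rightarrow> real \<Rightarrow>
     nat \<Rightarrow> ('g \<Rightarrow> nat \<Rightarrow> nat) \<Rightarrow> (nat \<Rightarrow> 'x) set" where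
  "Map X \<phi> \<rho> F \<delta> d \<sigma> =
     {\<xi> \<in> {1..d} \<rightarrow>\<^sub>E topspace X. \<forall>s\<in>F.
        sqrt (1 / real d * (\<Sum>a\<in>{1..d}. (\<rho> (\<xi> (\<sigma> s a)) (\<phi> s (\<xi> a)))\<^sup>2)) \<le> \<delta>}"

definition finite_open_cover :: "'a topology \<Rightarrow> 'a set set \<Rightarrow> bool" where
  "finite_open_cover K \<beta> \<longleftrightarrow> finite \<beta> \<and> (\<forall>U\<in>\<beta>. openin K U) \<and> \<Union>\<beta> = topspace K"

definition refines :: "'a set set \<Rightarrow> 'a set set \<Rightarrow> bool" where
  "refines \<gamma> \<beta> \<longleftrightarrow> (\<forall>V\<in>\<gamma>. \<exists>U\<in>\<beta>. V \<subseteq> U)"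

text \<open>
  The supremum and infimum below range over sets of integers bounded in the relevant direction,
  so for nonempty \<open>K\<close> they are a maximum and a minimum; for empty \<open>K\<close> both values
  are \<open>- \<infinity>\<close>, since the supremum of the empty set in \<open>ereal\<close> is \<open>- \<infinity>\<close>.
\<close>

definition cover_ord :: "'a topology \<Rightarrow> 'a set set \<Rightarrow> ereal" where
  "cover_ord K \<beta> = (SUP x\<in>topspace K. ereal ((\<Sum>U\<in>\<beta>. indicator U x) - 1))"

definition cover_dim :: "'a topology \<Rightarrow> 'a set set \<Rightarrow> ereal" where
  "cover_dim K \<beta> = (INF \<gamma>\<in>{\<gamma>. finite_open_cover K \<gamma> \<and> refines \<gamma> \<beta>}. cover_ord K \<gamma>)"

definition power_cover :: "'a set set \<Rightarrow> nat \<Rightarrow> (nat \<Rightarrow> 'a) set set" where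
  "power_cover \<alpha> d = (\<lambda>U. \<Pi>\<^sub>E j\<in>{1..d}. U j) ` ({1..d} \<rightarrow>\<^sub>E \<alpha>)"

definition map_cover_dim ::
    "'x topology \<Rightarrow> ('g \<Rightarrow> 'x \<Rightarrow> 'x) \<Rightarrow> 'y topology \<Rightarrow> ('x \<Rightarrow> 'y) \<Rightarrow> 'y set set \<Rightarrow>
     ('x \<Rightarrow> 'x \<Rightarrow> real) \<Rightarrow> 'g set \<Rightarrow> real \<Rightarrow> nat \<Rightarrow> ('g \<Rightarrow> nat \<Rightarrow> nat) \<Rightarrow> ereal" where
  "map_cover_dim X \<phi> Y \<pi> \<alpha> \<rho> F \<delta> d \<sigma> =
     (let K = compose {1..d} \<pi> ` Map X \<phi> \<rho> F \<delta> d \<sigma>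
      in cover_dim (subtopology (product_topology (\<lambda>_. Y) {1..d}) K)
           ((\<lambda>V. V \<inter> K) ` power_cover \<alpha> d))"

definition mdim_cover ::
    "('g, 'm) monoid_scheme \<Rightarrow> (nat \<Rightarrow> nat) \<Rightarrow> (nat \<Rightarrow> 'g \<Rightarrow> nat \<Rightarrow> nat) \<Rightarrow>
     'x topology \<Rightarrow> ('g \<Rightarrow> 'x \<Rightarrow> 'x) \<Rightarrow> ('x \<Rightarrow> 'x \<Rightarrow> real) \<Rightarrow> 'y topology \<Rightarrow> ('x \<Rightarrow> 'y) \<Rightarrow>
     'y set set \<Rightarrow> ereal" where
  "mdim_cover G d \<sigma> X \<phi> \<rho> Y \<pi> \<alpha> =
     (INF F\<in>{F. F \<subseteq> carrier G \<and> finite F \<and> F \<noteq> {}}. INF \<delta>\<in>{0<..}.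
        limsup (\<lambda>i. map_cover_dim X \<phi> Y \<pi> \<alpha> \<rho> F \<delta> (d i) (\<sigma> i) / ereal (real (d i))))"

definition mdim_rel ::
    "('g, 'm) monoid_scheme \<Rightarrow> (nat \<Rightarrow> nat) \<Rightarrow> (nat \<Rightarrow> 'g \<Rightarrow> nat \<Rightarrow> nat) \<Rightarrow>
     'x topology \<Rightarrow> ('g \<Rightarrow> 'x \<Rightarrow> 'x) \<Rightarrow> ('x \<Rightarrow> 'x \<Rightarrow> real) \<Rightarrow> 'y topology \<Rightarrow> ('x \<Rightarrow> 'y) \<Rightarrow>
     ereal" where
  "mdim_rel G d \<sigma> X \<phi> \<rho> Y \<pi> =
     (SUP \<alpha>\<in>{\<alpha>. finite_open_cover Y \<alpha>}. mdim_cover G d \<sigma> X \<phi> \<rho> Y \<pi> \<alpha>)"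

definition diagonal :: "nat \<Rightarrow> 'y topology \<Rightarrow> (nat \<Rightarrow> 'y) set" where
  "diagonal n Y = (\<lambda>c. \<lambda>i\<in>{1..n}. c) ` topspace Y"

definition admissible_cover :: "nat \<Rightarrow> 'y topology \<Rightarrow> (nat \<Rightarrow> 'y) \<Rightarrow> 'y set set \<Rightarrow> bool" where
  "admissible_cover n Y y \<alpha> \<longleftrightarrow>
     finite_open_cover Y \<alpha> \<and> (\<forall>U\<in>\<alpha>. \<not> y ` {1..n} \<subseteq> Y closure_of U)"

definition mdim_tuples ::
    "nat \<Rightarrow> ('g, 'm) monoid_scheme \<Rightarrow> (nat \<Rightarrow> nat) \<Rightarrow> (nat \<Rightarrow> 'g \<Rightarrow> nat \<Rightarrow> nat) \<Rightarrow>
     'x topology \<Rightarrow> ('g \<Rightarrow> 'x \<Rightarrow> 'x) \<Rightarrow> ('x \<Rightarrow> 'x \<Rightarrow> real) \<Rightarrow> 'y topology \<Rightarrow> ('x \<Rightarrow> 'y) \<Rightarrow>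
     (nat \<Rightarrow> 'y) set" where
  "mdim_tuples n G d \<sigma> X \<phi> \<rho> Y \<pi> =
     {y \<in> ({1..n} \<rightarrow>\<^sub>E topspace Y) - diagonal n Y.
        \<forall>\<alpha>. admissible_cover n Y y \<alpha> \<longrightarrow> mdim_cover G d \<sigma> X \<phi> \<rho> Y \<pi> \<alpha> > 0}"

end

theory Submission
  imports Defs
begin

text \<open>
  A tuple of \<open>Y\<close> that is off the diagonal has an admissible cover, because two distinct points of a
  metrizable space have open neighbourhoods with disjoint closures (\<open>admissible_cover_exists\<close>). If the tuple is a mean
  dimension tuple, that cover has positive mean dimension, and so has the factor.

  Conversely, let \<open>{U\<^sub>1, \<dots>, U\<^sub>n}\<close> be an open cover of positive mean dimension. The product of the
  closed sets \<open>Y - U\<^sub>j\<close> is compact and misses the diagonal, and it contains a mean dimension tuple.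
  Otherwise each of its points is admissible for some cover of mean dimension at most \<open>0\<close>. For
  a given cover admissibility is an open condition on the tuple, so finitely many such covers
  serve the whole product. Let \<open>\<eta>\<close> be their join. A member of \<open>\<eta>\<close> that is contained in no \<open>U\<^sub>j\<close>
  contains a whole tuple of the product, which is then admissible for none of these covers. Hence
  \<open>\<eta>\<close> refines the cover \<open>{U\<^sub>1, \<dots>, U\<^sub>n}\<close>, and \<open>\<eta>\<close> must have positive mean dimension.

  The contradiction comes from subadditivity, \<open>D(\<alpha> \<or> \<beta>) \<le> D(\<alpha>) + D(\<beta>)\<close> (\<open>cover_dim_join\<close>): it
  passes to the mean dimension and makes that of \<open>\<eta>\<close> at most \<open>0\<close>. It is usually
  derived from the dimension of a product of polyhedra. Here it is proved directly by the staircase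
  triangulation of a product of simplices, read as a refinement of covers. Let \<open>p\<^sub>i\<close> and \<open>q\<^sub>j\<close> be
  partitions of unity whose functions are positive exactly on the members of two given covers. At
  a point \<open>x\<close> the partial sums of the \<open>p\<^sub>i(x)\<close> and of the \<open>q\<^sub>j(x)\<close> cut the unit interval in two ways;
  let \<open>W\<^sub>i\<^sub>j\<close> be the set of \<open>x\<close> at which the \<open>i\<close>-th interval of the first subdivision and the \<open>j\<close>-th
  interval of the second overlap. These sets are open, cover the space and refine the join. If \<open>x\<close>
  lies in \<open>r\<close> members of the first cover and in \<open>s\<close> members of the second, then the common
  subdivision has at most \<open>r + s - 1\<close> nondegenerate intervals, so \<open>x\<close> lies in at most that many of
  the sets \<open>W\<^sub>i\<^sub>j\<close>. This is what additivity of the orders needs (\<open>common_refinement_multiplicity\<close>).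
\<close>

section \<open>The staircase count\<close>

lemma last_positive_term:
  fixes f :: "nat \<Rightarrow> real"
  assumes "\<And>i. i < m \<Longrightarrow> 0 \<le> f i" "0 < sum f {..<m}"
  shows "\<exists>i<m. 0 < f i \<and> sum f {..<Suc i} = sum f {..<m}"
  using assms
proof (induction m)
  case (Suc m)
  show ?case
  proof (cases "0 < f m")
    case False
    then have "f m = 0"
      using Suc.prems(1)[of m] by simp
    then obtain i where "i < m" "0 < f i" "sum f {..<Suc i} = sum f {..<m}"
      using Suc.IH Suc.prems by fastforce
    then show ?thesis
      using \<open>f m = 0\<close> by (intro exI[of _ i]) simp
  qed auto
qed auto

lemma unique_partial_sum_interval:
  fixes f :: "nat \<Rightarrow> real"
  assumes nonneg: "\<And>i. i < m \<Longrightarrow> 0 \<le> f i"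
    and i: "i < m" "sum f {..<i} < r" "r \<le> sum f {..<Suc i}"
    and i': "i' < m" "sum f {..<i'} < r" "r \<le> sum f {..<Suc i'}"
  shows "i = i'"
proof -
  have "sum f {..<Suc k} \<le> sum f {..<l}" if "k < l" "l < m" for k l
    by (rule sum_mono2) (use that nonneg in auto)
  then show ?thesis
    using i i' by (metis linorder_neqE_nat not_less order_less_le_trans)
qed

text \<open>
  The terms of \<open>f\<close> and of \<open>g\<close> are regarded as lengths of consecutive intervals starting at \<open>0\<close>.
\<close>

definition overlap :: "(nat \<Rightarrow> real) \<Rightarrow> (nat \<Rightarrow> real) \<Rightarrow> nat \<Rightarrow> nat \<Rightarrow> bool" where
  "overlap f g i j \<longleftrightarrow>
     max (sum f {..<i}) (sum g {..<j}) < min (sum f {..<Suc i}) (sum g {..<Suc j})"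

lemma overlap_pos: "overlap f g i j \<Longrightarrow> 0 < f i \<and> 0 < g j"
  by (auto simp: overlap_def)

text \<open>
  The last nondegenerate intervals of the two subdivisions end at the same point.
\<close>

lemma overlap_exists:
  assumes "\<And>i. i < m \<Longrightarrow> 0 \<le> f i" "\<And>j. j < n \<Longrightarrow> 0 \<le> g j"
    and "sum f {..<m} = sum g {..<n}" "0 < sum f {..<m}"
  shows "\<exists>i<m. \<exists>j<n. overlap f g i j"
proof -
  obtain i where "i < m" "0 < f i" "sum f {..<Suc i} = sum f {..<m}"
    using last_positive_term[of m f] assms by auto
  moreover obtain j where "j < n" "0 < g j" "sum g {..<Suc j} = sum g {..<n}"
    using last_positive_term[of n g] assms by auto
  ultimately have "overlap f g i j"
    using assms(3) unfolding overlap_def by simp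
  with \<open>i < m\<close> \<open>j < n\<close> show ?thesis by blast
qed

text \<open>
  Distinct overlaps are disjoint intervals, so they have distinct right endpoints, and each right
  endpoint is that of an interval of positive length of \<open>f\<close> or of \<open>g\<close>. The endpoint of the whole
  segment is counted for both, which saves one.
\<close>

lemma card_overlap:
  assumes f: "\<And>i. i < m \<Longrightarrow> 0 \<le> f i" and g: "\<And>j. j < n \<Longrightarrow> 0 \<le> g j"
    and eq: "sum f {..<m} = sum g {..<n}" and pos: "0 < sum f {..<m}"
  shows "card {(i, j). i < m \<and> j < n \<and> overlap f g i j} + 1
       \<le> card {i. i < m \<and> 0 < f i} + card {j. j < n \<and> 0 < g j}"
proof -
  define P where "P = {(i, j). i < m \<and> j < n \<and> overlap f g i j}"
  define A where "A = (\<lambda>i. sum f {..<Suc i}) ` {i. i < m \<and> 0 < f i}"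
  define B where "B = (\<lambda>j. sum g {..<Suc j}) ` {j. j < n \<and> 0 < g j}"
  define r where "r = (\<lambda>(i, j). min (sum f {..<Suc i}) (sum g {..<Suc j}))"
  have "inj_on r P"
  proof (rule inj_onI)
    fix p q assume "p \<in> P" "q \<in> P" "r p = r q"
    then obtain i j i' j' where pq: "p = (i, j)" "q = (i', j')"
      and lt: "i < m" "j < n" "i' < m" "j' < n"
      and ov: "overlap f g i j" "overlap f g i' j'"
      by (auto simp: P_def)
    have "i = i'"
      by (rule unique_partial_sum_interval[of m f i "r p"])
        (use f lt ov \<open>r p = r q\<close> pq in \<open>auto simp: r_def overlap_def\<close>)
    moreover have "j = j'"
      by (rule unique_partial_sum_interval[of n g j "r p"])
        (use g lt ov \<open>r p = r q\<close> pq in \<open>auto simp: r_def overlap_def\<close>)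
    ultimately show "p = q" using pq by simp
  qed
  moreover have "r ` P \<subseteq> A \<union> B"
  proof
    fix t assume "t \<in> r ` P"
    then obtain i j where ij: "i < m" "j < n" "overlap f g i j"
      and t: "t = min (sum f {..<Suc i}) (sum g {..<Suc j})"
      by (auto simp: P_def r_def)
    have "sum f {..<Suc i} \<in> A" "sum g {..<Suc j} \<in> B"
      using ij overlap_pos[OF ij(3)] unfolding A_def B_def by blast+
    then show "t \<in> A \<union> B"
      unfolding t by (auto simp: min_def)
  qed
  moreover have fin: "finite A" "finite B"
    by (auto simp: A_def B_def)
  ultimately have "card P \<le> card (A \<union> B)"
    by (meson card_inj_on_le finite_UnI)
  moreover have "card (A \<union> B) + card (A \<inter> B) = card A + card B"
    using card_Un_Int[OF fin] by simp
  moreover have "sum f {..<m} \<in> A \<inter> B"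
  proof
    show "sum f {..<m} \<in> A"
      using last_positive_term[of m f] f pos unfolding A_def
      by (smt (verit, best) imageI mem_Collect_eq)
    show "sum f {..<m} \<in> B"
      using last_positive_term[of n g] g pos eq unfolding B_def
      by (smt (verit, best) imageI mem_Collect_eq)
  qed
  then have "card (A \<inter> B) \<ge> 1"
    using fin by (metis One_nat_def Suc_leI card_gt_0_iff empty_iff finite_Int)
  moreover have "card A \<le> card {i. i < m \<and> 0 < f i}" "card B \<le> card {j. j < n \<and> 0 < g j}"
    unfolding A_def B_def by (auto intro: card_image_le)
  ultimately show ?thesis
    unfolding P_def by linarith
qed

section \<open>Partitions of unity\<close>

text \<open>
  The function is the distance to the complement of \<open>U\<close>, or \<open>1\<close> if the complement is empty.
\<close>

lemma metrizable_space_cozero: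
  assumes K: "metrizable_space K" and U: "openin K U"
  obtains h where "continuous_map K euclideanreal h"
    "\<And>x. x \<in> topspace K \<Longrightarrow> 0 \<le> h x" "\<And>x. x \<in> topspace K \<Longrightarrow> 0 < h x \<longleftrightarrow> x \<in> U"
proof (cases "U = topspace K")
  case True
  then show ?thesis
    using that[of "\<lambda>_. 1"] by simp
next
  case False
  obtain M e where "Metric_space M e" and Keq: "K = Metric_space.mtopology M e"
    using K metrizable_space_def by blast
  interpret Metric_space M e by fact
  have top: "topspace K = M"
    using Keq by simp
  define C where "C = M - U"
  have "C \<noteq> {}" "C \<subseteq> M"
    using False U openin_subset top by (auto simp: C_def)
  define h where "h x = (INF z\<in>C. e x z)" for x
  have bdd: "bdd_below ((\<lambda>z. e x z) ` C)" for x
    by (rule bdd_belowI[of _ 0]) auto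
  have nonneg: "0 \<le> h x" for x
    unfolding h_def using \<open>C \<noteq> {}\<close> by (intro cINF_greatest) auto
  have half: "h x \<le> h y + e x y" if "x \<in> M" "y \<in> M" for x y
  proof -
    have "h x - e x y \<le> e y z" if "z \<in> C" for z
    proof -
      have "h x \<le> e x z"
        unfolding h_def using bdd that by (rule cINF_lower)
      also have "\<dots> \<le> e x y + e y z"
        using \<open>x \<in> M\<close> \<open>y \<in> M\<close> that \<open>C \<subseteq> M\<close> by (intro triangle) auto
      finally show ?thesis by simp
    qed
    then have "h x - e x y \<le> h y"
      unfolding h_def[of y] using \<open>C \<noteq> {}\<close> by (intro cINF_greatest) (auto simp: h_def)
    then show ?thesis by simp
  qed
  have "Lipschitz_continuous_map Self euclidean_metric h"
    unfolding Lipschitz_continuous_map_def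
  proof (intro conjI exI ballI)
    fix x y assume "x \<in> mspace Self" "y \<in> mspace Self"
    then show "mdist euclidean_metric (h x) (h y) \<le> 1 * mdist Self x y"
      using half[of x y] half[of y x] by (simp add: dist_real_def commute)
  qed auto
  then have "continuous_map K euclideanreal h"
    using Lipschitz_continuous_imp_continuous_map[of Self euclidean_metric h] Keq by (simp add: mtopology_of_def)
  moreover have "0 < h x \<longleftrightarrow> x \<in> U" if "x \<in> M" for x
  proof
    assume "0 < h x"
    moreover have "h x \<le> 0" if "x \<in> C"
      using cINF_lower[OF bdd[of x] that] \<open>x \<in> M\<close> by (simp add: h_def)
    ultimately show "x \<in> U"
      using \<open>x \<in> M\<close> by (force simp: C_def)
  next
    assume "x \<in> U"
    then obtain \<epsilon> where "\<epsilon> > 0" and ball: "mball x \<epsilon> \<subseteq> U"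
      using U Keq openin_mtopology by auto
    have "\<epsilon> \<le> h x"
      unfolding h_def
    proof (rule cINF_greatest[OF \<open>C \<noteq> {}\<close>])
      fix z assume "z \<in> C"
      then have "z \<notin> mball x \<epsilon>" "z \<in> M"
        using ball by (auto simp: C_def)
      then show "\<epsilon> \<le> e x z"
        using \<open>x \<in> M\<close> by auto
    qed
    then show "0 < h x"
      using \<open>\<epsilon> > 0\<close> by simp
  qed
  ultimately show ?thesis
    using that nonneg top by blast
qed

text \<open>
  The sets of positivity are the prescribed open sets themselves, not merely subsets of them, so the
  number of positive functions at a point is the number of sets containing it.
\<close>

lemma partition_of_unity_exact_support:
  assumes K: "metrizable_space K"
    and op: "\<And>i. i < m \<Longrightarrow> openin K (U i)" and cov: "topspace K \<subseteq> (\<Union>i<m. U i)"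
  obtains p :: "nat \<Rightarrow> 'a \<Rightarrow> real"
  where "\<And>i. i < m \<Longrightarrow> continuous_map K euclideanreal (p i)"
    "\<And>i x. i < m \<Longrightarrow> x \<in> topspace K \<Longrightarrow> 0 \<le> p i x"
    "\<And>i x. i < m \<Longrightarrow> x \<in> topspace K \<Longrightarrow> 0 < p i x \<longleftrightarrow> x \<in> U i"
    "\<And>x. x \<in> topspace K \<Longrightarrow> (\<Sum>i<m. p i x) = 1"
proof -
  have "\<exists>h. continuous_map K euclideanreal h \<and>
      (\<forall>x\<in>topspace K. 0 \<le> h x \<and> (0 < h x \<longleftrightarrow> x \<in> U i))" if "i < m" for i
    using metrizable_space_cozero[OF K op[OF that]] by metis
  then obtain h where h: "\<And>i. i < m \<Longrightarrow> continuous_map K euclideanreal (h i)"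
      "\<And>i x. i < m \<Longrightarrow> x \<in> topspace K \<Longrightarrow> 0 \<le> h i x"
      "\<And>i x. i < m \<Longrightarrow> x \<in> topspace K \<Longrightarrow> 0 < h i x \<longleftrightarrow> x \<in> U i"
    by metis
  define s where "s x = (\<Sum>i<m. h i x)" for x
  have s: "0 < s x" if "x \<in> topspace K" for x
  proof -
    obtain i where "i < m" "x \<in> U i"
      using cov \<open>x \<in> topspace K\<close> by blast
    then show ?thesis
      unfolding s_def using h \<open>x \<in> topspace K\<close> by (intro sum_pos2[of _ i]) auto
  qed
  have cs: "continuous_map K euclideanreal s"
    unfolding s_def using h(1) by (intro continuous_map_sum) auto
  show ?thesis
  proof (rule that[of "\<lambda>i x. h i x / s x"])
    show "continuous_map K euclideanreal (\<lambda>x. h i x / s x)" if "i < m" for i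
      using h(1)[OF that] cs s by (intro continuous_map_real_divide) force+
    show "0 \<le> h i x / s x" if "i < m" "x \<in> topspace K" for i x
      using h(2)[OF that] s[OF that(2)] by simp
    show "0 < h i x / s x \<longleftrightarrow> x \<in> U i" if "i < m" "x \<in> topspace K" for i x
      using h(3)[OF that] s[OF that(2)] by (simp add: zero_less_divide_iff)
    show "(\<Sum>i<m. h i x / s x) = 1" if "x \<in> topspace K" for x
      using s[OF that] by (simp add: s_def flip: sum_divide_distrib)
  qed
qed

section \<open>Subadditivity of the dimension of a cover\<close>

definition cover_join :: "'a set set \<Rightarrow> 'a set set \<Rightarrow> 'a set set" where
  "cover_join \<alpha> \<beta> = (\<lambda>(U, V). U \<inter> V) ` (\<alpha> \<times> \<beta>)"

text \<open>
  The order of a cover is its largest number of members at a point, minus one. In terms of orders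
  the bound is therefore additive, whereas for the join itself the multiplicities multiply, which
  would say nothing after division by \<open>d\<close>.
\<close>

lemma common_refinement_multiplicity:
  assumes K: "metrizable_space K"
    and \<gamma>: "finite_open_cover K \<gamma>" and \<gamma>': "finite_open_cover K \<gamma>'"
  obtains \<eta> where "finite_open_cover K \<eta>" "refines \<eta> (cover_join \<gamma> \<gamma>')"
    "\<And>x. x \<in> topspace K \<Longrightarrow>
       card {W\<in>\<eta>. x \<in> W} + 1 \<le> card {U\<in>\<gamma>. x \<in> U} + card {V\<in>\<gamma>'. x \<in> V}"
proof -
  define m n where "m = card \<gamma>" and "n = card \<gamma>'"
  obtain U where U: "bij_betw U {..<m} \<gamma>"
    using \<gamma> ex_bij_betw_nat_finite[of \<gamma>]
    by (auto simp: m_def finite_open_cover_def lessThan_atLeast0)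
  obtain V where V: "bij_betw V {..<n} \<gamma>'"
    using \<gamma>' ex_bij_betw_nat_finite[of \<gamma>']
    by (auto simp: n_def finite_open_cover_def lessThan_atLeast0)
  have U_mem: "U i \<in> \<gamma>" if "i < m" for i
    using U that by (auto simp: bij_betw_def)
  have V_mem: "V j \<in> \<gamma>'" if "j < n" for j
    using V that by (auto simp: bij_betw_def)
  have cover: "topspace K \<subseteq> (\<Union>i<m. U i)" "topspace K \<subseteq> (\<Union>j<n. V j)"
    using \<gamma> \<gamma>' U V by (auto simp: finite_open_cover_def bij_betw_def)
  have opens: "openin K (U i)" if "i < m" for i
    using U_mem[OF that] \<gamma> by (simp add: finite_open_cover_def)
  have opens': "openin K (V j)" if "j < n" for j
    using V_mem[OF that] \<gamma>' by (simp add: finite_open_cover_def)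
  obtain p :: "nat \<Rightarrow> 'a \<Rightarrow> real"
    where p: "\<And>i. i < m \<Longrightarrow> continuous_map K euclideanreal (p i)"
      "\<And>i x. i < m \<Longrightarrow> x \<in> topspace K \<Longrightarrow> 0 \<le> p i x"
      "\<And>i x. i < m \<Longrightarrow> x \<in> topspace K \<Longrightarrow> 0 < p i x \<longleftrightarrow> x \<in> U i"
      "\<And>x. x \<in> topspace K \<Longrightarrow> (\<Sum>i<m. p i x) = 1"
    using partition_of_unity_exact_support[OF K opens cover(1)] by blast
  obtain q :: "nat \<Rightarrow> 'a \<Rightarrow> real"
    where q: "\<And>j. j < n \<Longrightarrow> continuous_map K euclideanreal (q j)"
      "\<And>j x. j < n \<Longrightarrow> x \<in> topspace K \<Longrightarrow> 0 \<le> q j x"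
      "\<And>j x. j < n \<Longrightarrow> x \<in> topspace K \<Longrightarrow> 0 < q j x \<longleftrightarrow> x \<in> V j"
      "\<And>x. x \<in> topspace K \<Longrightarrow> (\<Sum>j<n. q j x) = 1"
    using partition_of_unity_exact_support[OF K opens' cover(2)] by blast
  define W where "W i j = {x \<in> topspace K. overlap (\<lambda>i. p i x) (\<lambda>j. q j x) i j}" for i j
  define \<eta> where "\<eta> = (\<lambda>(i, j). W i j) ` ({..<m} \<times> {..<n})"
  have open_W: "openin K (W i j)" if "i < m" "j < n" for i j
  proof -
    define h where "h x = min (\<Sum>k<Suc i. p k x) (\<Sum>k<Suc j. q k x)
        - max (\<Sum>k<i. p k x) (\<Sum>k<j. q k x)" for x
    have "continuous_map K euclideanreal h"
      unfolding h_def using that p(1) q(1)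
      by (intro continuous_map_diff continuous_map_real_max continuous_map_real_min
          continuous_map_sum) auto
    moreover have "W i j = {x \<in> topspace K. h x \<in> {0<..}}"
      by (auto simp: W_def overlap_def h_def)
    ultimately show ?thesis
      using openin_continuous_map_preimage[of K euclideanreal h "{0<..}"] by simp
  qed
  have W_sub: "W i j \<subseteq> U i \<inter> V j" if "i < m" "j < n" for i j
    using that p(3) q(3) overlap_pos unfolding W_def by fastforce
  show ?thesis
  proof (rule that[of \<eta>])
    have "topspace K \<subseteq> \<Union>\<eta>"
    proof
      fix x assume x: "x \<in> topspace K"
      then have "\<exists>i<m. \<exists>j<n. overlap (\<lambda>i. p i x) (\<lambda>j. q j x) i j"
        using p q by (intro overlap_exists) auto
      then show "x \<in> \<Union>\<eta>"
        using x unfolding \<eta>_def W_def by fastforce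
    qed
    then show "finite_open_cover K \<eta>"
      using open_W by (auto simp: finite_open_cover_def \<eta>_def W_def)
    show "refines \<eta> (cover_join \<gamma> \<gamma>')"
      unfolding refines_def
    proof
      fix A assume "A \<in> \<eta>"
      then obtain i j where ij: "i < m" "j < n" "A = W i j"
        by (auto simp: \<eta>_def)
      then have "U i \<inter> V j \<in> cover_join \<gamma> \<gamma>'"
        using U_mem V_mem unfolding cover_join_def by auto
      then show "\<exists>B\<in>cover_join \<gamma> \<gamma>'. A \<subseteq> B"
        using W_sub ij by blast
    qed
    fix x assume x: "x \<in> topspace K"
    let ?P = "{(i, j). i < m \<and> j < n \<and> overlap (\<lambda>i. p i x) (\<lambda>j. q j x) i j}"
    have finP: "finite ?P"
      by (rule finite_subset[of _ "{..<m} \<times> {..<n}"]) auto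
    have "{A\<in>\<eta>. x \<in> A} \<subseteq> (\<lambda>(i, j). W i j) ` ?P"
      by (auto simp: \<eta>_def W_def)
    then have "card {A\<in>\<eta>. x \<in> A} \<le> card ?P"
      using finP by (meson card_image_le card_mono finite_imageI le_trans)
    moreover have "card ?P + 1 \<le> card {i. i < m \<and> 0 < p i x} + card {j. j < n \<and> 0 < q j x}"
      using p q x by (intro card_overlap) auto
    moreover have "card {i. i < m \<and> 0 < p i x} \<le> card {A\<in>\<gamma>. x \<in> A}"
      by (rule card_inj_on_le[of U])
        (use U p(3) x \<gamma> in \<open>auto simp: bij_betw_def inj_on_def finite_open_cover_def\<close>)
    moreover have "card {j. j < n \<and> 0 < q j x} \<le> card {A\<in>\<gamma>'. x \<in> A}"
      by (rule card_inj_on_le[of V])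
        (use V q(3) x \<gamma>' in \<open>auto simp: bij_betw_def inj_on_def finite_open_cover_def\<close>)
    ultimately show "card {A\<in>\<eta>. x \<in> A} + 1 \<le> card {A\<in>\<gamma>. x \<in> A} + card {A\<in>\<gamma>'. x \<in> A}"
      by linarith
  qed
qed

lemma refines_trans: "refines \<alpha> \<beta> \<Longrightarrow> refines \<beta> \<gamma> \<Longrightarrow> refines \<alpha> \<gamma>"
  unfolding refines_def by (meson subset_trans)

lemma refines_cover_join:
  "refines \<alpha> \<alpha>' \<Longrightarrow> refines \<beta> \<beta>' \<Longrightarrow> refines (cover_join \<alpha> \<beta>) (cover_join \<alpha>' \<beta>')"
proof -
  assume \<alpha>: "refines \<alpha> \<alpha>'" and \<beta>: "refines \<beta> \<beta>'"
  show ?thesis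
    unfolding refines_def
  proof
    fix W assume "W \<in> cover_join \<alpha> \<beta>"
    then obtain U V where W: "W = U \<inter> V" "U \<in> \<alpha>" "V \<in> \<beta>"
      by (auto simp: cover_join_def)
    then obtain U' V' where "U' \<in> \<alpha>'" "U \<subseteq> U'" "V' \<in> \<beta>'" "V \<subseteq> V'"
      using \<alpha> \<beta> unfolding refines_def by blast
    then show "\<exists>W'\<in>cover_join \<alpha>' \<beta>'. W \<subseteq> W'"
      unfolding cover_join_def W(1) by (intro bexI[of _ "U' \<inter> V'"]) auto
  qed
qed

lemma refines_cover_join_left: "refines (cover_join \<alpha> \<beta>) \<alpha>"
  and refines_cover_join_right: "refines (cover_join \<alpha> \<beta>) \<beta>"
  unfolding refines_def cover_join_def by auto

lemma finite_open_cover_join: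
  "finite_open_cover K \<alpha> \<Longrightarrow> finite_open_cover K \<beta> \<Longrightarrow> finite_open_cover K (cover_join \<alpha> \<beta>)"
  unfolding finite_open_cover_def cover_join_def by (auto; blast)

lemma sum_indicator_card:
  "finite \<beta> \<Longrightarrow> (\<Sum>U\<in>\<beta>. indicator U x) = real (card {U\<in>\<beta>. x \<in> U})"
  by (simp add: indicator_def sum.If_cases Int_def)

lemma cover_dim_refines:
  "refines \<beta> \<alpha> \<Longrightarrow> cover_dim K \<alpha> \<le> cover_dim K \<beta>"
  unfolding cover_dim_def by (rule INF_superset_mono) (use refines_trans in blast, simp)

text \<open>
  Subadditivity of the dimension of covers, in a form that avoids adding infinite values.
\<close>

lemma cover_dim_join:
  assumes K: "metrizable_space K"
    and "cover_dim K \<alpha> < ereal a" "cover_dim K \<beta> < ereal b"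
  shows "cover_dim K (cover_join \<alpha> \<beta>) \<le> ereal (a + b)"
proof -
  obtain \<gamma> \<gamma>' where \<gamma>: "finite_open_cover K \<gamma>" "refines \<gamma> \<alpha>" "cover_ord K \<gamma> < ereal a"
    and \<gamma>': "finite_open_cover K \<gamma>'" "refines \<gamma>' \<beta>" "cover_ord K \<gamma>' < ereal b"
    using assms(2,3) unfolding cover_dim_def INF_less_iff by auto
  obtain \<eta> where \<eta>: "finite_open_cover K \<eta>" "refines \<eta> (cover_join \<gamma> \<gamma>')"
    "\<And>x. x \<in> topspace K \<Longrightarrow>
       card {W\<in>\<eta>. x \<in> W} + 1 \<le> card {U\<in>\<gamma>. x \<in> U} + card {V\<in>\<gamma>'. x \<in> V}"
    using common_refinement_multiplicity[OF K \<gamma>(1) \<gamma>'(1)] by blast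
  have mult: "real (card {U\<in>\<delta>. x \<in> U}) - 1 < c"
    if "finite_open_cover K \<delta>" "cover_ord K \<delta> < ereal c" "x \<in> topspace K" for \<delta> c x
  proof -
    have "ereal ((\<Sum>U\<in>\<delta>. indicator U x) - 1) \<le> cover_ord K \<delta>"
      unfolding cover_ord_def using that(3) by (rule SUP_upper)
    then have "ereal ((\<Sum>U\<in>\<delta>. indicator U x) - 1) < ereal c"
      using that(2) by (rule order_le_less_trans)
    then show ?thesis
      using that(1) by (simp add: sum_indicator_card finite_open_cover_def)
  qed
  have "cover_ord K \<eta> \<le> ereal (a + b)"
    unfolding cover_ord_def
  proof (rule SUP_least)
    fix x assume "x \<in> topspace K"
    then have "real (card {W\<in>\<eta>. x \<in> W}) - 1 \<le> a + b"
      using \<eta>(3)[of x] mult[OF \<gamma>(1,3), of x] mult[OF \<gamma>'(1,3), of x] by linarith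
    then show "ereal ((\<Sum>U\<in>\<eta>. indicator U x) - 1) \<le> ereal (a + b)"
      using \<eta>(1) by (simp add: sum_indicator_card finite_open_cover_def)
  qed
  moreover have "refines \<eta> (cover_join \<alpha> \<beta>)"
    by (rule refines_trans[OF \<eta>(2) refines_cover_join[OF \<gamma>(2) \<gamma>'(2)]])
  ultimately show ?thesis
    unfolding cover_dim_def using \<eta>(1) by (intro INF_lower2[of \<eta>]) auto
qed

lemma cover_dim_subspace:
  assumes "K' \<subseteq> K" "K \<subseteq> topspace Z"
  shows "cover_dim (subtopology Z K') ((\<lambda>V. V \<inter> K') ` \<beta>)
       \<le> cover_dim (subtopology Z K) ((\<lambda>V. V \<inter> K) ` \<beta>)"
  unfolding cover_dim_def
proof (rule INF_mono)
  fix \<gamma> assume "\<gamma> \<in> {\<gamma>. finite_open_cover (subtopology Z K) \<gamma> \<and> refines \<gamma> ((\<lambda>V. V \<inter> K) ` \<beta>)}"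
  then have \<gamma>: "finite_open_cover (subtopology Z K) \<gamma>" "refines \<gamma> ((\<lambda>V. V \<inter> K) ` \<beta>)"
    by auto
  define \<gamma>' where "\<gamma>' = (\<lambda>V. V \<inter> K') ` \<gamma>"
  have top: "topspace (subtopology Z K) = K" "topspace (subtopology Z K') = K'"
    using assms by auto
  have "openin (subtopology Z K') (V \<inter> K')" if V: "openin (subtopology Z K) V" for V
  proof -
    obtain T where "openin Z T" "V = T \<inter> K"
      using V by (auto simp: openin_subtopology)
    moreover have "T \<inter> K \<inter> K' = T \<inter> K'"
      using assms(1) by blast
    ultimately show ?thesis
      by (auto simp: openin_subtopology)
  qed
  moreover have "\<Union>\<gamma> = K"
    using \<gamma>(1) unfolding finite_open_cover_def top by blast
  then have "\<Union>\<gamma>' = K'"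
    using assms(1) by (auto simp: \<gamma>'_def)
  ultimately have foc: "finite_open_cover (subtopology Z K') \<gamma>'"
    using \<gamma>(1) unfolding finite_open_cover_def top(2) by (auto simp: \<gamma>'_def)
  have ref: "refines \<gamma>' ((\<lambda>V. V \<inter> K') ` \<beta>)"
    unfolding refines_def
  proof
    fix W assume "W \<in> \<gamma>'"
    then obtain V B where "W = V \<inter> K'" "B \<in> \<beta>" "V \<subseteq> B \<inter> K"
      using \<gamma>(2) unfolding refines_def \<gamma>'_def by auto
    then show "\<exists>C\<in>(\<lambda>V. V \<inter> K') ` \<beta>. W \<subseteq> C"
      by (intro bexI[of _ "B \<inter> K'"]) auto
  qed
  have fin: "finite \<gamma>" "finite \<gamma>'"
    using \<gamma>(1) by (auto simp: finite_open_cover_def \<gamma>'_def)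
  have "cover_ord (subtopology Z K') \<gamma>' \<le> cover_ord (subtopology Z K) \<gamma>"
    unfolding cover_ord_def top
  proof (rule SUP_mono)
    fix x assume x: "x \<in> K'"
    have "{W\<in>\<gamma>'. x \<in> W} = (\<lambda>V. V \<inter> K') ` {V\<in>\<gamma>. x \<in> V}"
      using x by (auto simp: \<gamma>'_def)
    then have "card {W\<in>\<gamma>'. x \<in> W} \<le> card {V\<in>\<gamma>. x \<in> V}"
      using fin by (simp add: card_image_le)
    then show "\<exists>y\<in>K. ereal ((\<Sum>U\<in>\<gamma>'. indicator U x) - 1) \<le> ereal ((\<Sum>U\<in>\<gamma>. indicator U y) - 1)"
      using x assms(1) fin by (intro bexI[of _ x]) (auto simp: sum_indicator_card)
  qed
  then show "\<exists>\<gamma>'\<in>{\<gamma>. finite_open_cover (subtopology Z K') \<gamma> \<and> refines \<gamma> ((\<lambda>V. V \<inter> K') ` \<beta>)}.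
      cover_ord (subtopology Z K') \<gamma>' \<le> cover_ord (subtopology Z K) \<gamma>"
    using foc ref by blast
qed

text \<open>
  The cover by the whole space has order \<open>0\<close>. Over the empty space it has to be replaced by the
  empty family, as the empty set need not be contained in a member of \<open>\<beta>\<close>.
\<close>

lemma cover_dim_trivial:
  assumes "topspace K \<noteq> {} \<Longrightarrow> topspace K \<in> \<beta>"
  shows "cover_dim K \<beta> \<le> 0"
proof -
  define \<gamma> where "\<gamma> = {topspace K} - {{}}"
  have "finite_open_cover K \<gamma>"
    by (auto simp: finite_open_cover_def \<gamma>_def)
  moreover have "refines \<gamma> \<beta>"
    using assms unfolding refines_def \<gamma>_def by blast
  moreover have "cover_ord K \<gamma> \<le> 0"
    unfolding cover_ord_def \<gamma>_def
    using card_mono[of "{topspace K}" "{topspace K} - {{}}"]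
    by (intro SUP_least) (auto simp: zero_ereal_def sum_indicator_card)
  ultimately show ?thesis
    unfolding cover_dim_def by (intro INF_lower2[of \<gamma>]) auto
qed

section \<open>Admissible covers\<close>

text \<open>
  Admissibility requires, for each of finitely many sets \<open>V\<close>, that some coordinate avoid the
  closed set \<open>Y closure_of V\<close>.
\<close>

lemma openin_admissible:
  assumes "finite_open_cover Y \<gamma>"
  shows "openin (product_topology (\<lambda>_. Y) {1..n})
    {y \<in> {1..n} \<rightarrow>\<^sub>E topspace Y. admissible_cover n Y y \<gamma>}"
proof -
  let ?P = "product_topology (\<lambda>_. Y) {1..n}"
  let ?W = "\<lambda>V j. {y \<in> topspace ?P. y j \<in> topspace Y - Y closure_of V}"
  have "openin ?P (?W V j)" if "j \<in> {1..n}" for j V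
    by (rule openin_continuous_map_preimage[of ?P Y])
      (use that in \<open>auto intro: continuous_map_product_projection openin_diff\<close>)
  then have "openin ?P (\<Union>j\<in>{1..n}. ?W V j)" for V
    by (intro openin_Union) blast
  then have "openin ?P ((\<Inter>V\<in>\<gamma>. \<Union>j\<in>{1..n}. ?W V j) \<inter> topspace ?P)"
    using assms by (intro openin_INT) (auto simp only: finite_open_cover_def)
  also have "(\<Inter>V\<in>\<gamma>. \<Union>j\<in>{1..n}. ?W V j) \<inter> topspace ?P
      = {y \<in> {1..n} \<rightarrow>\<^sub>E topspace Y. admissible_cover n Y y \<gamma>}"
    using assms by (auto simp: admissible_cover_def image_subset_iff PiE_iff extensional_def)
  finally show ?thesis .
qed

lemma admissible_cover_exists:
  assumes met: "metrizable_space Y"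
    and y: "y \<in> ({1..n} \<rightarrow>\<^sub>E topspace Y) - diagonal n Y" and "n \<ge> 2"
  shows "\<exists>\<alpha>. admissible_cover n Y y \<alpha>"
proof -
  have "\<exists>j\<in>{1..n}. y j \<noteq> y 1"
  proof (rule ccontr)
    assume "\<not> ?thesis"
    then have const: "\<And>j. j \<in> {1..n} \<Longrightarrow> y j = y 1"
      by blast
    have "y \<in> extensional {1..n}"
      using y by (simp add: PiE_iff)
    then have "y = (\<lambda>j\<in>{1..n}. y 1)"
      by (rule extensionalityI[OF _ restrict_extensional]) (simp only: const restrict_apply')
    moreover have "y 1 \<in> topspace Y"
      using y \<open>n \<ge> 2\<close> by (auto simp: PiE_iff)
    ultimately show False
      using y unfolding diagonal_def by blast
  qed
  then obtain j where j: "j \<in> {1..n}" "y j \<noteq> y 1" by blast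
  have top: "y 1 \<in> topspace Y" "y j \<in> topspace Y"
    using y j \<open>n \<ge> 2\<close> by (auto simp: PiE_iff)
  obtain A B where AB: "openin Y A" "openin Y B" "y 1 \<in> A" "y j \<in> B" "disjnt A B"
    using metrizable_imp_Hausdorff_space[OF met] top j unfolding Hausdorff_space_def by metis
  \<comment> \<open>One member stays away from \<open>y 1\<close>, the other covers what this leaves out and stays
    away from \<open>y j\<close>.\<close>
  then have "y j \<in> topspace Y - Y closure_of A"
    using top by (auto simp: in_closure_of disjnt_def)
  then obtain U V where UV: "openin Y U" "openin Y V" "Y closure_of A \<subseteq> U" "y j \<in> V" "disjnt U V"
    using metrizable_imp_regular_space[OF met] closedin_closure_of
    unfolding regular_space_def by (metis disjnt_sym)
  have "y 1 \<notin> Y closure_of (topspace Y - Y closure_of A)"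
    using AB(1,3) closure_of_subset[OF openin_subset[OF AB(1)]] by (auto simp: in_closure_of)
  moreover have "y j \<notin> Y closure_of U"
    using UV by (auto simp: in_closure_of disjnt_def)
  moreover have "openin Y (topspace Y - Y closure_of A)"
    by auto
  ultimately have "admissible_cover n Y y {topspace Y - Y closure_of A, U}"
    unfolding admissible_cover_def finite_open_cover_def
    using UV(1,3) openin_subset[OF UV(1)] j(1) \<open>n \<ge> 2\<close> by (auto simp: image_subset_iff)
  then show ?thesis by blast
qed

section \<open>Relative sofic mean dimension of covers\<close>

lemma map_cover_dim_refines:
  assumes "refines \<beta> \<alpha>"
  shows "map_cover_dim X \<phi> Y \<pi> \<alpha> \<rho> F \<delta> n \<tau> \<le> map_cover_dim X \<phi> Y \<pi> \<beta> \<rho> F \<delta> n \<tau>"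
  unfolding map_cover_dim_def Let_def
proof (rule cover_dim_refines)
  obtain r where r: "\<And>V. V \<in> \<beta> \<Longrightarrow> r V \<in> \<alpha> \<and> V \<subseteq> r V"
    using assms unfolding refines_def by metis
  let ?K = "compose {1..n} \<pi> ` Map X \<phi> \<rho> F \<delta> n \<tau>"
  show "refines ((\<lambda>V. V \<inter> ?K) ` power_cover \<beta> n) ((\<lambda>V. V \<inter> ?K) ` power_cover \<alpha> n)"
    unfolding refines_def
  proof
    fix A assume "A \<in> (\<lambda>V. V \<inter> ?K) ` power_cover \<beta> n"
    then obtain V where V: "V \<in> {1..n} \<rightarrow>\<^sub>E \<beta>" and A: "A = Pi\<^sub>E {1..n} V \<inter> ?K"
      by (auto simp: power_cover_def)
    define U where "U = (\<lambda>j\<in>{1..n}. r (V j))"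
    have "U \<in> {1..n} \<rightarrow>\<^sub>E \<alpha>"
      using V r by (simp add: U_def PiE_iff)
    moreover have "Pi\<^sub>E {1..n} V \<subseteq> Pi\<^sub>E {1..n} U"
      using V r by (intro PiE_mono) (simp add: U_def PiE_iff)
    then have "A \<subseteq> Pi\<^sub>E {1..n} U \<inter> ?K"
      unfolding A by blast
    ultimately show "\<exists>B\<in>(\<lambda>V. V \<inter> ?K) ` power_cover \<alpha> n. A \<subseteq> B"
      unfolding power_cover_def by blast
  qed
qed

locale factor_of_G_systems =
  fixes G :: "('g, 'm) monoid_scheme"
    and d :: "nat \<Rightarrow> nat" and \<sigma> :: "nat \<Rightarrow> 'g \<Rightarrow> nat \<Rightarrow> nat"
    and X :: "'x topology" and \<phi> :: "'g \<Rightarrow> 'x \<Rightarrow> 'x" and \<rho> :: "'x \<Rightarrow> 'x \<Rightarrow> real"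
    and Y :: "'y topology" and \<psi> :: "'g \<Rightarrow> 'y \<Rightarrow> 'y" and \<pi> :: "'x \<Rightarrow> 'y"
  assumes sofic: "sofic_group G"
    and approx: "sofic_approximation G d \<sigma>"
    and sysY: "G_system G Y \<psi>"
    and factor: "factor_map G X \<phi> Y \<psi> \<pi>"
begin

abbreviation "mdim \<equiv> mdim_cover G d \<sigma> X \<phi> \<rho> Y \<pi>"

abbreviation "image_Map F \<delta> i \<equiv> compose {1..d i} \<pi> ` Map X \<phi> \<rho> F \<delta> (d i) (\<sigma> i)"

lemma eventually_d_pos: "eventually (\<lambda>i. 0 < d i) sequentially"
  using approx eventually_gt_at_top[of 0] unfolding sofic_approximation_def filterlim_iff by auto

lemma image_Map_subset: "image_Map F \<delta> i \<subseteq> {1..d i} \<rightarrow>\<^sub>E topspace Y"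
proof
  fix y assume "y \<in> image_Map F \<delta> i"
  then obtain \<xi> where "\<xi> \<in> {1..d i} \<rightarrow>\<^sub>E topspace X" "y = compose {1..d i} \<pi> \<xi>"
    by (auto simp: Map_def)
  moreover have "\<pi> \<in> topspace X \<rightarrow> topspace Y"
    using factor by (auto simp: factor_map_def)
  ultimately show "y \<in> {1..d i} \<rightarrow>\<^sub>E topspace Y"
    by (fastforce simp: compose_def PiE_iff)
qed

lemma image_Map_mono: "F \<subseteq> F' \<Longrightarrow> \<delta>' \<le> \<delta> \<Longrightarrow> image_Map F' \<delta>' i \<subseteq> image_Map F \<delta> i"
  unfolding Map_def by (intro image_mono) (blast intro: order_trans)

lemma map_cover_dim_mono:
  assumes "F \<subseteq> F'" "\<delta>' \<le> \<delta>"
  shows "map_cover_dim X \<phi> Y \<pi> \<alpha> \<rho> F' \<delta>' (d i) (\<sigma> i) \<le> map_cover_dim X \<phi> Y \<pi> \<alpha> \<rho> F \<delta> (d i) (\<sigma> i)"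
  unfolding map_cover_dim_def Let_def
  by (rule cover_dim_subspace[OF image_Map_mono[OF assms]])
    (simp only: topspace_product_topology image_Map_subset)

text \<open>
  Taking \<open>d\<close>-th powers commutes with joins, so subadditivity applies in the space
  \<open>\<pi>\<^sup>d(Map)\<close>, which is metrizable as a subspace of \<open>Y\<^sup>d\<close>.
\<close>

lemma map_cover_dim_join:
  assumes "map_cover_dim X \<phi> Y \<pi> \<alpha> \<rho> F \<delta> (d i) (\<sigma> i) < ereal a"
    and "map_cover_dim X \<phi> Y \<pi> \<beta> \<rho> F \<delta> (d i) (\<sigma> i) < ereal b"
  shows "map_cover_dim X \<phi> Y \<pi> (cover_join \<alpha> \<beta>) \<rho> F \<delta> (d i) (\<sigma> i) \<le> ereal (a + b)"
proof -
  let ?K = "image_Map F \<delta> i"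
  let ?S = "subtopology (product_topology (\<lambda>_. Y) {1..d i}) ?K"
  let ?R = "\<lambda>\<alpha>. (\<lambda>V. V \<inter> ?K) ` power_cover \<alpha> (d i)"
  have "metrizable_space ?S"
    using sysY
    by (auto simp: G_system_def metrizable_space_product_topology intro!: metrizable_space_subtopology)
  then have "cover_dim ?S (cover_join (?R \<alpha>) (?R \<beta>)) \<le> ereal (a + b)"
    using assms unfolding map_cover_dim_def Let_def by (rule cover_dim_join)
  moreover have "refines (cover_join (?R \<alpha>) (?R \<beta>)) (?R (cover_join \<alpha> \<beta>))"
    unfolding refines_def
  proof
    fix A assume "A \<in> cover_join (?R \<alpha>) (?R \<beta>)"
    then obtain U V where UV: "U \<in> {1..d i} \<rightarrow>\<^sub>E \<alpha>" "V \<in> {1..d i} \<rightarrow>\<^sub>E \<beta>"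
      and A: "A = (Pi\<^sub>E {1..d i} U \<inter> ?K) \<inter> (Pi\<^sub>E {1..d i} V \<inter> ?K)"
      by (auto simp: cover_join_def power_cover_def)
    define W where "W = (\<lambda>j\<in>{1..d i}. U j \<inter> V j)"
    have "W \<in> {1..d i} \<rightarrow>\<^sub>E cover_join \<alpha> \<beta>"
      using UV by (auto simp: W_def cover_join_def PiE_iff)
    then have "Pi\<^sub>E {1..d i} W \<inter> ?K \<in> ?R (cover_join \<alpha> \<beta>)"
      unfolding power_cover_def by blast
    moreover have "A \<subseteq> Pi\<^sub>E {1..d i} W \<inter> ?K"
      unfolding A W_def by (simp add: PiE_iff subset_iff)
    ultimately show "\<exists>B\<in>?R (cover_join \<alpha> \<beta>). A \<subseteq> B" by blast
  qed
  ultimately show ?thesis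
    unfolding map_cover_dim_def Let_def by (meson cover_dim_refines order_trans)
qed

lemma mdim_refines: "refines \<beta> \<alpha> \<Longrightarrow> mdim \<alpha> \<le> mdim \<beta>"
  unfolding mdim_cover_def
  by (intro INF_mono' Limsup_mono eventually_mono[OF eventually_d_pos] ereal_divide_right_mono
      map_cover_dim_refines) auto

lemma mdim_less_imp_eventually:
  assumes "mdim \<alpha> < ereal \<epsilon>"
  shows "\<exists>F \<delta>. F \<subseteq> carrier G \<and> finite F \<and> F \<noteq> {} \<and> 0 < \<delta> \<and>
    eventually (\<lambda>i. map_cover_dim X \<phi> Y \<pi> \<alpha> \<rho> F \<delta> (d i) (\<sigma> i) < ereal (\<epsilon> * real (d i)))
      sequentially"
proof -
  from assms obtain F \<delta> where F: "F \<subseteq> carrier G" "finite F" "F \<noteq> {}" "0 < \<delta>"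
    and lt: "limsup (\<lambda>i. map_cover_dim X \<phi> Y \<pi> \<alpha> \<rho> F \<delta> (d i) (\<sigma> i) / ereal (real (d i))) < ereal \<epsilon>"
    unfolding mdim_cover_def INF_less_iff by auto
  have "eventually (\<lambda>i. map_cover_dim X \<phi> Y \<pi> \<alpha> \<rho> F \<delta> (d i) (\<sigma> i) < ereal (\<epsilon> * real (d i)))
      sequentially"
    using Limsup_lessD[OF lt] eventually_d_pos
    by eventually_elim (simp add: ereal_divide_less_iff)
  then show ?thesis
    using F by blast
qed

text \<open>
  The two covers may need different \<open>F\<close> and \<open>\<delta>\<close>. Enlarging \<open>F\<close> and decreasing \<open>\<delta>\<close> shrinks the set of
  maps, which only lowers the dimension of the induced cover, so a common choice works for both.
\<close>

lemma mdim_join_nonpos: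
  assumes "mdim \<alpha> \<le> 0" "mdim \<beta> \<le> 0"
  shows "mdim (cover_join \<alpha> \<beta>) \<le> 0"
proof (rule ereal_le_epsilon2)
  fix e :: real assume "0 < e"
  define \<epsilon> where "\<epsilon> = e / 2"
  have "0 < \<epsilon>" using \<open>0 < e\<close> by (simp add: \<epsilon>_def)
  then have lt: "mdim \<alpha> < ereal \<epsilon>" "mdim \<beta> < ereal \<epsilon>"
    using assms by (auto intro: order_le_less_trans)
  obtain F \<delta> where F: "F \<subseteq> carrier G" "finite F" "F \<noteq> {}" "0 < \<delta>"
    and evF: "eventually (\<lambda>i. map_cover_dim X \<phi> Y \<pi> \<alpha> \<rho> F \<delta> (d i) (\<sigma> i) < ereal (\<epsilon> * real (d i)))
      sequentially"
    using mdim_less_imp_eventually[OF lt(1)] by blast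
  obtain F' \<delta>' where F': "F' \<subseteq> carrier G" "finite F'" "F' \<noteq> {}" "0 < \<delta>'"
    and evF': "eventually (\<lambda>i. map_cover_dim X \<phi> Y \<pi> \<beta> \<rho> F' \<delta>' (d i) (\<sigma> i) < ereal (\<epsilon> * real (d i)))
      sequentially"
    using mdim_less_imp_eventually[OF lt(2)] by blast
  let ?F = "F \<union> F'" and ?\<delta> = "min \<delta> \<delta>'"
  have "eventually (\<lambda>i. map_cover_dim X \<phi> Y \<pi> (cover_join \<alpha> \<beta>) \<rho> ?F ?\<delta> (d i) (\<sigma> i)
      / ereal (real (d i)) \<le> ereal e) sequentially"
    using evF evF' eventually_d_pos
  proof eventually_elim
    case (elim i)
    have "map_cover_dim X \<phi> Y \<pi> \<alpha> \<rho> ?F ?\<delta> (d i) (\<sigma> i) < ereal (\<epsilon> * real (d i))"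
      by (rule order_le_less_trans[OF map_cover_dim_mono elim(1)]) auto
    moreover have "map_cover_dim X \<phi> Y \<pi> \<beta> \<rho> ?F ?\<delta> (d i) (\<sigma> i) < ereal (\<epsilon> * real (d i))"
      by (rule order_le_less_trans[OF map_cover_dim_mono elim(2)]) auto
    ultimately have "map_cover_dim X \<phi> Y \<pi> (cover_join \<alpha> \<beta>) \<rho> ?F ?\<delta> (d i) (\<sigma> i)
        \<le> ereal (\<epsilon> * real (d i) + \<epsilon> * real (d i))"
      by (rule map_cover_dim_join)
    also have "\<dots> = ereal e * ereal (real (d i))"
      by (simp add: \<epsilon>_def field_simps)
    finally show ?case
      using elim(3) by (simp add: ereal_divide_le_pos mult.commute)
  qed
  then have "limsup (\<lambda>i. map_cover_dim X \<phi> Y \<pi> (cover_join \<alpha> \<beta>) \<rho> ?F ?\<delta> (d i) (\<sigma> i)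
      / ereal (real (d i))) \<le> ereal e"
    by (rule Limsup_bounded)
  then have "mdim (cover_join \<alpha> \<beta>) \<le> ereal e"
    unfolding mdim_cover_def using F F' by (intro INF_lower2[of ?F] INF_lower2[of ?\<delta>]) auto
  then show "mdim (cover_join \<alpha> \<beta>) \<le> 0 + ereal e" by simp
qed

text \<open>
  This excludes degenerate covers of positive mean dimension: those over an empty \<open>Y\<close>, and those
  with the whole space as a member.
\<close>

lemma mdim_trivial:
  assumes "topspace Y \<noteq> {} \<Longrightarrow> topspace Y \<in> \<alpha>"
  shows "mdim \<alpha> \<le> 0"
proof -
  have "group G" using sofic by (simp add: sofic_group_def)
  then have one: "{\<one>\<^bsub>G\<^esub>} \<subseteq> carrier G"
    by (simp add: group.is_monoid monoid.one_closed)
  have "eventually (\<lambda>i. map_cover_dim X \<phi> Y \<pi> \<alpha> \<rho> {\<one>\<^bsub>G\<^esub>} 1 (d i) (\<sigma> i)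
      / ereal (real (d i)) \<le> 0) sequentially"
    using eventually_d_pos
  proof eventually_elim
    case (elim i)
    let ?K = "image_Map {\<one>\<^bsub>G\<^esub>} 1 i"
    let ?S = "subtopology (product_topology (\<lambda>_. Y) {1..d i}) ?K"
    have top: "topspace ?S = ?K"
      by (simp only: topspace_subtopology topspace_product_topology Int_absorb1[OF image_Map_subset])
    have "map_cover_dim X \<phi> Y \<pi> \<alpha> \<rho> {\<one>\<^bsub>G\<^esub>} 1 (d i) (\<sigma> i) \<le> 0"
      unfolding map_cover_dim_def Let_def
    proof (rule cover_dim_trivial)
      assume "topspace ?S \<noteq> {}"
      then obtain y where "y \<in> {1..d i} \<rightarrow>\<^sub>E topspace Y"
        unfolding top using image_Map_subset by blast
      then have "y 1 \<in> topspace Y"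
        using elim by (auto simp: PiE_iff)
      then have "topspace Y \<in> \<alpha>" using assms by blast
      then have "(\<lambda>j\<in>{1..d i}. topspace Y) \<in> {1..d i} \<rightarrow>\<^sub>E \<alpha>" by simp
      moreover have "Pi\<^sub>E {1..d i} (\<lambda>j\<in>{1..d i}. topspace Y) = {1..d i} \<rightarrow>\<^sub>E topspace Y"
        by (rule PiE_cong) simp
      ultimately have "({1..d i} \<rightarrow>\<^sub>E topspace Y) \<in> power_cover \<alpha> (d i)"
        unfolding power_cover_def by (metis image_eqI)
      moreover have "topspace ?S = ({1..d i} \<rightarrow>\<^sub>E topspace Y) \<inter> ?K"
        unfolding top using image_Map_subset by blast
      ultimately show "topspace ?S \<in> (\<lambda>V. V \<inter> ?K) ` power_cover \<alpha> (d i)"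
        by blast
    qed
    then show ?case
      using elim by (simp add: ereal_divide_le_pos)
  qed
  then have "limsup (\<lambda>i. map_cover_dim X \<phi> Y \<pi> \<alpha> \<rho> {\<one>\<^bsub>G\<^esub>} 1 (d i) (\<sigma> i)
      / ereal (real (d i))) \<le> 0"
    by (rule Limsup_bounded)
  then show ?thesis
    unfolding mdim_cover_def using one
    by (intro INF_lower2[of "{\<one>\<^bsub>G\<^esub>}"] INF_lower2[of 1]) auto
qed

lemma common_refinement_mdim_nonpos:
  assumes "finite \<Gamma>" "\<And>\<gamma>. \<gamma> \<in> \<Gamma> \<Longrightarrow> mdim \<gamma> \<le> 0" "\<And>\<gamma>. \<gamma> \<in> \<Gamma> \<Longrightarrow> finite_open_cover Y \<gamma>"
  shows "\<exists>\<eta>. finite_open_cover Y \<eta> \<and> mdim \<eta> \<le> 0 \<and> (\<forall>\<gamma>\<in>\<Gamma>. refines \<eta> \<gamma>)"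
  using assms
proof (induction \<Gamma>)
  case empty
  then show ?case
    by (intro exI[of _ "{topspace Y}"]) (simp add: finite_open_cover_def mdim_trivial)
next
  case (insert \<gamma> \<Gamma>)
  then obtain \<eta> where "finite_open_cover Y \<eta>" "mdim \<eta> \<le> 0" "\<forall>\<gamma>\<in>\<Gamma>. refines \<eta> \<gamma>"
    by auto
  with insert.prems show ?case
    by (intro exI[of _ "cover_join \<gamma> \<eta>"])
      (auto intro: finite_open_cover_join mdim_join_nonpos refines_cover_join_left
        refines_trans[OF refines_cover_join_right])
qed

section \<open>Localizing positive mean dimension at a tuple\<close>

text \<open>
  By compactness of the product of the closed sets \<open>Y - U j\<close>, a failure at every tuple of this
  product would come from finitely many covers, whose join refines the given one. Since the sets
  \<open>U j\<close> cover \<open>Y\<close>, the tuple obtained is off the diagonal.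
\<close>

lemma positive_tuple_avoiding_cover:
  assumes \<alpha>: "finite_open_cover Y (U ` {1..n})" and pos: "mdim (U ` {1..n}) > 0"
  shows "\<exists>y \<in> \<Pi>\<^sub>E j\<in>{1..n}. topspace Y - U j.
    \<forall>\<gamma>. admissible_cover n Y y \<gamma> \<longrightarrow> mdim \<gamma> > 0"
proof (rule ccontr)
  assume neg: "\<not> ?thesis"
  let ?P = "product_topology (\<lambda>_. Y) {1..n}"
  let ?C = "\<Pi>\<^sub>E j\<in>{1..n}. topspace Y - U j"
  define Adm where "Adm \<gamma> = {y \<in> {1..n} \<rightarrow>\<^sub>E topspace Y. admissible_cover n Y y \<gamma>}" for \<gamma>
  define \<Gamma> where "\<Gamma> = {\<gamma>. finite_open_cover Y \<gamma> \<and> mdim \<gamma> \<le> 0}"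
  have "compactin Y (topspace Y - U j)" if "j \<in> {1..n}" for j
    using sysY \<alpha> that
    by (intro closedin_compact_space) (auto simp: G_system_def finite_open_cover_def)
  then have "compactin ?P ?C"
    by (simp add: compactin_PiE)
  moreover have "?C \<subseteq> \<Union>(Adm ` \<Gamma>)"
  proof
    fix y assume y: "y \<in> ?C"
    then obtain \<gamma> where "admissible_cover n Y y \<gamma>" "mdim \<gamma> \<le> 0"
      using neg by (meson linorder_not_less)
    then show "y \<in> \<Union>(Adm ` \<Gamma>)"
      using y by (auto simp: Adm_def \<Gamma>_def admissible_cover_def PiE_iff)
  qed
  moreover have "openin ?P A" if "A \<in> Adm ` \<Gamma>" for A
    using that openin_admissible by (auto simp: Adm_def \<Gamma>_def)
  ultimately obtain \<A> where "finite \<A>" "\<A> \<subseteq> Adm ` \<Gamma>" "?C \<subseteq> \<Union>\<A>"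
    unfolding compactin_def by blast
  then obtain \<Gamma>' where \<Gamma>': "finite \<Gamma>'" "\<Gamma>' \<subseteq> \<Gamma>" "?C \<subseteq> \<Union>(Adm ` \<Gamma>')"
    by (metis finite_subset_image)
  then obtain \<eta> where \<eta>: "finite_open_cover Y \<eta>" "mdim \<eta> \<le> 0" "\<forall>\<gamma>\<in>\<Gamma>'. refines \<eta> \<gamma>"
    using common_refinement_mdim_nonpos[of \<Gamma>'] by (auto simp: \<Gamma>_def)
  have "refines \<eta> (U ` {1..n})"
    unfolding refines_def
  proof (rule ballI, rule ccontr)
    fix V assume "V \<in> \<eta>" and "\<not> (\<exists>A\<in>U ` {1..n}. V \<subseteq> A)"
    then have "\<exists>z. z \<in> V - U j" if "j \<in> {1..n}" for j
      using that by blast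
    \<comment> \<open>A tuple of the product all of whose coordinates lie in the single set \<open>V\<close>.\<close>
    then obtain z where z: "\<And>j. j \<in> {1..n} \<Longrightarrow> z j \<in> V - U j"
      by metis
    define y where "y = restrict z {1..n}"
    have "V \<subseteq> topspace Y"
      using \<open>V \<in> \<eta>\<close> \<eta>(1) by (auto simp: finite_open_cover_def)
    then have "y \<in> ?C"
      using z by (auto simp: y_def)
    then obtain \<gamma> where "\<gamma> \<in> \<Gamma>'" and adm: "admissible_cover n Y y \<gamma>"
      using \<Gamma>'(3) by (auto simp: Adm_def)
    then obtain V' where "V' \<in> \<gamma>" "V \<subseteq> V'"
      using \<eta>(3) \<open>V \<in> \<eta>\<close> unfolding refines_def by blast
    moreover have "V' \<subseteq> Y closure_of V'"
      using \<open>V' \<in> \<gamma>\<close> adm by (intro closure_of_subset)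
        (auto simp: admissible_cover_def finite_open_cover_def)
    ultimately have "y ` {1..n} \<subseteq> Y closure_of V'"
      using z unfolding y_def by fastforce
    then show False
      using adm \<open>V' \<in> \<gamma>\<close> by (auto simp: admissible_cover_def)
  qed
  then have "mdim (U ` {1..n}) \<le> 0"
    by (rule order_trans[OF mdim_refines \<eta>(2)])
  with pos show False by simp
qed

lemma mdim_tuples_nonempty:
  assumes "mdim_rel G d \<sigma> X \<phi> \<rho> Y \<pi> > 0"
  shows "\<exists>n\<ge>2. mdim_tuples n G d \<sigma> X \<phi> \<rho> Y \<pi> \<noteq> {}"
proof -
  obtain \<alpha> where \<alpha>: "finite_open_cover Y \<alpha>" "mdim \<alpha> > 0"
    using assms unfolding mdim_rel_def less_SUP_iff by auto
  then have triv: "topspace Y \<noteq> {}" "topspace Y \<notin> \<alpha>"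
    using mdim_trivial[of \<alpha>] by force+
  define n where "n = card \<alpha>"
  obtain U where U: "bij_betw U {1..n} \<alpha>"
    using \<alpha>(1) ex_bij_betw_nat_finite_1[of \<alpha>] by (auto simp: n_def finite_open_cover_def)
  then have U\<alpha>: "U ` {1..n} = \<alpha>"
    by (simp add: bij_betw_def)
  obtain y where y: "y \<in> (\<Pi>\<^sub>E j\<in>{1..n}. topspace Y - U j)"
    and pos: "\<forall>\<gamma>. admissible_cover n Y y \<gamma> \<longrightarrow> mdim \<gamma> > 0"
    using positive_tuple_avoiding_cover[of U n] \<alpha> U\<alpha> by auto
  have cover: "(\<Union>j\<in>{1..n}. U j) = topspace Y"
    using \<alpha>(1) U\<alpha> by (simp add: finite_open_cover_def)
  have "n \<noteq> 0"
    using triv(1) unfolding cover[symmetric] by auto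
  moreover have "n \<noteq> 1"
  proof
    assume "n = 1"
    then have "U 1 = topspace Y" "U 1 \<in> \<alpha>"
      using cover U\<alpha> by auto
    with triv(2) show False by simp
  qed
  ultimately have "n \<ge> 2" by simp
  have "y \<notin> diagonal n Y"
  proof
    assume "y \<in> diagonal n Y"
    then obtain c where "c \<in> topspace Y" "\<And>j. j \<in> {1..n} \<Longrightarrow> y j = c"
      by (auto simp: diagonal_def)
    moreover from this obtain j where "j \<in> {1..n}" "c \<in> U j"
      using cover by blast
    ultimately have "j \<in> {1..n}" "y j \<in> U j"
      by simp_all
    with y show False by (auto simp: PiE_iff)
  qed
  moreover have "y \<in> {1..n} \<rightarrow>\<^sub>E topspace Y"
    using y by (auto simp: PiE_iff)
  ultimately have "y \<in> mdim_tuples n G d \<sigma> X \<phi> \<rho> Y \<pi>"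
    using pos by (auto simp: mdim_tuples_def)
  then show ?thesis
    using \<open>n \<ge> 2\<close> by blast
qed

end

theorem theorem6p6:
  fixes G :: "('g, 'm) monoid_scheme"
    and d :: "nat \<Rightarrow> nat" and \<sigma> :: "nat \<Rightarrow> 'g \<Rightarrow> nat \<Rightarrow> nat"
    and X :: "'x topology" and \<phi> :: "'g \<Rightarrow> 'x \<Rightarrow> 'x" and \<rho> :: "'x \<Rightarrow> 'x \<Rightarrow> real"
    and Y :: "'y topology" and \<psi> :: "'g \<Rightarrow> 'y \<Rightarrow> 'y" and \<pi> :: "'x \<Rightarrow> 'y"
  assumes "sofic_group G"
    and "sofic_approximation G d \<sigma>"
    and "G_system G X \<phi>"
    and "G_system G Y \<psi>"
    and "factor_map G X \<phi> Y \<psi> \<pi>"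
    and "compatible_metric X \<rho>"
  shows "mdim_rel G d \<sigma> X \<phi> \<rho> Y \<pi> > 0 \<longleftrightarrow>
         (\<exists>n\<ge>2. mdim_tuples n G d \<sigma> X \<phi> \<rho> Y \<pi> \<noteq> {})"
proof -
  interpret factor_of_G_systems G d \<sigma> X \<phi> \<rho> Y \<psi> \<pi>
    by unfold_locales fact+
  show ?thesis
  proof
    assume "\<exists>n\<ge>2. mdim_tuples n G d \<sigma> X \<phi> \<rho> Y \<pi> \<noteq> {}"
    then obtain n y where "n \<ge> 2" and y: "y \<in> mdim_tuples n G d \<sigma> X \<phi> \<rho> Y \<pi>"
      by blast
    then obtain \<alpha> where \<alpha>: "admissible_cover n Y y \<alpha>"
      using admissible_cover_exists[of Y y n] sysY
      unfolding mdim_tuples_def G_system_def by blast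
    then have "0 < mdim \<alpha>" "finite_open_cover Y \<alpha>"
      using y by (auto simp: mdim_tuples_def admissible_cover_def)
    then show "mdim_rel G d \<sigma> X \<phi> \<rho> Y \<pi> > 0"
      unfolding mdim_rel_def less_SUP_iff by blast
  qed (rule mdim_tuples_nonempty)
qed

end
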